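(* For odd $k$ and $\ell=\lceil k/2\rceil$, the number of I-matchings of $X_{2k}$ of size $k$ is $\frac{1}{\ell}\binom{4\ell-2}{\ell-1}$.
   Context: Let $k\ge 1$ and let $X_{2k}=\{P_1,\dots,P_{2k}\}$ be $2k$ points in convex position in the plane, labeled in clockwise cyclic order; indices are taken modulo $2k$. A matching of $X_{2k}$ means a set of $k$ pairwise non-crossing straight segments (edges) with endpoints in $X_{2k}$ covering every point exactly once; its size is $k$. Matchings with different labels are counted as different. A block of a matching $M$ is a pair of edges $\{P_iP_{i+3},P_{i+1}P_{i+2}\}\subseteq M$. If $K$ is a block of a matching $N$ of size $k+2$, then $N-K$ denotes the set $N\setminus K$, regarded as a matching of the remaining $2k$ points (which are in convex position) with their inherited cyclic order, i.e. as a matching of size $k$ defined up to cyclic relabeling. I-matchings are defined recursively: the unique matching of size $1$ is an I-matching; for odd $k\ge 3$, a matching $N$ of size $k$ is an I-matching iff it has a block $K$ such that $N-K$ is an I-matching (this notion is invariant under cyclic relabeling). *)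

theory Defs
  imports Complex_Main
begin

text \<open>Points P_1..P_{2n} in convex position, clockwise, are modelled as 0..2n-1
  (P_{j+1} is point j); indices modulo 2n.  An edge is a 2-element set of points.\<close>

definition is_edge :: "nat \<Rightarrow> nat set \<Rightarrow> bool" where
  "is_edge n e \<longleftrightarrow> (\<exists>a b. a < b \<and> b < 2*n \<and> e = {a, b})"

text \<open>Two chords of a convex polygon cross iff their endpoints strictly interleave.\<close>
definition crossing :: "nat set \<Rightarrow> nat set \<Rightarrow> bool" where
  "crossing e f \<longleftrightarrow> (\<exists>a b c d. e = {a, b} \<and> f = {c, d} \<and> a < c \<and> c < b \<and> b < d)"

definition is_matching :: "nat \<Rightarrow> nat set set \<Rightarrow> bool" where
  "is_matching n M \<longleftrightarrow>
     (\<forall>e\<in>M. is_edge n e) \<and>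
     (\<forall>p<2*n. \<exists>!e. e \<in> M \<and> p \<in> e) \<and>
     (\<forall>e\<in>M. \<forall>f\<in>M. \<not> crossing e f)"

definition block :: "nat \<Rightarrow> nat \<Rightarrow> nat set set" where
  "block n i = {{i mod (2*n), (i+3) mod (2*n)}, {(i+1) mod (2*n), (i+2) mod (2*n)}}"

text \<open>N - K for the block at i: remove the block, and relabel the remaining 2n-4 points
  in inherited cyclic order, point i+4 becoming 0 (any cyclic relabelling gives the same notion).\<close>
definition remove_block :: "nat \<Rightarrow> nat \<Rightarrow> nat set set \<Rightarrow> nat set set" where
  "remove_block n i M =
     (\<lambda>e. (\<lambda>x. (x + 2*n - (i + 4) mod (2*n)) mod (2*n)) ` e) ` (M - block n i)"

inductive I_matching :: "nat \<Rightarrow> nat set set \<Rightarrow> bool" where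
  base: "I_matching 1 {{0, 1}}"
| step: "\<lbrakk> odd n; 3 \<le> n; is_matching n M; i < 2*n; block n i \<subseteq> M;
           I_matching (n - 2) (remove_block n i M) \<rbrakk> \<Longrightarrow> I_matching n M"

end

theory Submission
  imports Defs "HOL-Computational_Algebra.Formal_Power_Series"
begin

text \<open>The regions cut out by a matching form a plane tree, whose edges are the chords; a block is a
  path of length two hanging off this tree.  Hence a matching of odd size is an I-matching iff its
  tree has a perfect matching.  Splitting a matching at the chord of its first point gives a
  binary tree, and the condition becomes a local one on the parities of the two subtrees.  It is
  invariant under rotation, so every block may be rotated to the last four points.
  With A and B the generating functions (by number of chords) of the admissible trees of odd and
  even size, B = 1 + xAB and A = x(A^2 + B^2), hence A = xB^3 and B = 1 + x^2 B^4, and the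
  coefficients of the powers of B follow from B^(r+1) = B^r + x^2 B^(r+4).\<close>

section \<open>Binary trees and non-crossing matchings\<close>

datatype bt = Lf | Nd bt bt

text \<open>A tree stands for a matching of an interval starting at p: the first chord, the matching
  \<open>l\<close> below it and the matching \<open>r\<close> to its right.\<close>
fun enc :: "nat \<Rightarrow> bt \<Rightarrow> nat set set" where
  "enc p Lf = {}"
| "enc p (Nd l r) =
     insert {p, p + 2 * size l + 1} (enc (p + 1) l \<union> enc (p + 2 * size l + 2) r)"

text \<open>For odd size: the tree of regions has a perfect matching.  For even size: it has a matching
  missing only the outer region.  The excluded parities would match the outer region twice.\<close>
fun good :: "bt \<Rightarrow> bool" where
  "good Lf \<longleftrightarrow> True"
| "good (Nd l r) \<longleftrightarrow> good l \<and> good r \<and> \<not> (even (size l) \<and> odd (size r))"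

text \<open>Juxtaposition of matchings of adjacent intervals: the outermost chords lie along the
  right spine, and \<open>t\<close> takes the place of the leaf ending it.\<close>

fun app :: "bt \<Rightarrow> bt \<Rightarrow> bt" where
  "app Lf t = t"
| "app (Nd l r) t = Nd l (app r t)"

lemma size_eq_1: "size t = 1 \<Longrightarrow> t = Nd Lf Lf"
proof (cases t)
  case (Nd a b)
  assume "size t = 1"
  then show ?thesis using Nd by (cases a; cases b) simp_all
qed simp

lemma size_app [simp]: "size (app s t) = size s + size t"
  by (induction s) auto

text \<open>A good tree of odd size matches its outer region; two of them side by side would match
  the common outer region twice.\<close>

lemma good_app: "good (app s t) \<longleftrightarrow> good s \<and> good t \<and> \<not> (odd (size s) \<and> odd (size t))"
  by (induction s) auto

lemma enc_app: "enc p (app s t) = enc p s \<union> enc (p + 2 * size s) t"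
  by (induction s arbitrary: p) (auto simp: algebra_simps)

lemma enc_range: "e \<in> enc p t \<Longrightarrow> e \<subseteq> {p..<p + 2 * size t}"
  by (induction t arbitrary: p) (fastforce dest!: subsetD)+

lemma enc_nonempty: "e \<in> enc p t \<Longrightarrow> e \<noteq> {}"
  by (induction t arbitrary: p) auto

lemma enc_is_pair:
  "e \<in> enc p t \<Longrightarrow> \<exists>a b. e = {a, b} \<and> p \<le> a \<and> a < b \<and> b < p + 2 * size t"
proof (induction t arbitrary: p)
  case (Nd l r)
  then consider "e = {p, p + 2 * size l + 1}" | "e \<in> enc (p + 1) l"
    | "e \<in> enc (p + 2 * size l + 2) r" by auto
  then show ?case
  proof cases
    case 1
    then show ?thesis by (intro exI[of _ p] exI[of _ "p + 2 * size l + 1"]) auto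
  next
    case 2
    from Nd.IH(1)[OF this] obtain a b where
      "e = {a, b}" "p + 1 \<le> a" "a < b" "b < p + 1 + 2 * size l" by blast
    then show ?thesis by (intro exI[of _ a] exI[of _ b]) auto
  next
    case 3
    from Nd.IH(2)[OF this] obtain a b where
      "e = {a, b}" "p + 2 * size l + 2 \<le> a" "a < b" "b < p + 2 * size l + 2 + 2 * size r" by blast
    then show ?thesis by (intro exI[of _ a] exI[of _ b]) auto
  qed
qed simp

text \<open>Meant for rotations modulo \<open>2 * n\<close>, which act as translations on every
  interval that they do not break.\<close>

lemma image_enc:
  assumes "\<And>x. x < 2 * size t \<Longrightarrow> f (p + x) = q + x"
  shows "(\<lambda>e. f ` e) ` enc p t = enc q t"
  using assms
proof (induction t arbitrary: p q)
  case (Nd l r)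
  have 1: "(\<lambda>e. f ` e) ` enc (p + 1) l = enc (q + 1) l"
    by (rule Nd.IH(1)) (use Nd.prems[of "_ + 1"] in \<open>auto simp: algebra_simps\<close>)
  have 2: "(\<lambda>e. f ` e) ` enc (p + 2 * size l + 2) r = enc (q + 2 * size l + 2) r"
    by (rule Nd.IH(2)) (use Nd.prems[of "_ + 2 * size l + 2"] in \<open>auto simp: algebra_simps\<close>)
  show ?case
    using Nd.prems[of 0] Nd.prems[of "2 * size l + 1"] by (simp add: image_Un 1[simplified] 2[simplified])
qed simp

text \<open>The chord at \<open>p\<close> fixes the size of \<open>l\<close>, hence the intervals of
  both subtrees; their encodings are then recovered as the chords inside these intervals.\<close>

lemma enc_inj: "enc p s = enc p t \<Longrightarrow> s = t"
proof (induction s arbitrary: p t)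
  case Lf
  then show ?case by (cases t) auto
next
  case (Nd l r)
  then obtain l' r' where t: "t = Nd l' r'" by (cases t) auto
  have edge0: "e = {p, p + 2 * size a + 1}" if "e \<in> enc p (Nd a b)" "p \<in> e" for e a b
    using that enc_range[of e "p + 1" a] enc_range[of e "p + 2 * size a + 2" b] by fastforce
  have "{p, p + 2 * size l + 1} \<in> enc p (Nd l' r')"
    using Nd.prems t by (metis enc.simps(2) insertI1)
  from edge0[OF this] have "{p, p + 2 * size l + 1} = {p, p + 2 * size l' + 1}" by simp
  then have sz: "size l = size l'" by (auto simp: doubleton_eq_iff)
  \<comment> \<open>\<open>enc_nonempty\<close> enters because an empty chord would lie in every
    interval.\<close>
  have inner: "enc (p + 1) a = {e \<in> enc p (Nd a b). e \<subseteq> {p + 1..<p + 1 + 2 * size a}}" for a b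
    using enc_range[of _ "p + 1" a] enc_range[of _ "p + 2 * size a + 2" b]
      enc_nonempty[of _ "p + 2 * size a + 2" b] by fastforce
  have outer: "enc (p + 2 * size a + 2) b
      = {e \<in> enc p (Nd a b). e \<subseteq> {p + 2 * size a + 2..}}" for a b
    using enc_range[of _ "p + 1" a] enc_range[of _ "p + 2 * size a + 2" b]
      enc_nonempty[of _ "p + 1" a] by fastforce
  have "enc (p + 1) l = enc (p + 1) l'"
    unfolding inner[of l r] inner[of l' r'] using Nd.prems t sz by simp
  moreover have "enc (p + 2 * size l + 2) r = enc (p + 2 * size l + 2) r'"
    unfolding outer[of l r] outer[of l' r', folded sz] Nd.prems[unfolded t] ..
  ultimately show ?case using Nd.IH t by blast
qed

lemma not_crossing_separated:
  assumes "e \<subseteq> {a..<b}" "f \<inter> {a..<b} = {}"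
  shows "\<not> crossing e f" "\<not> crossing f e"
  using assms unfolding crossing_def by force+

lemma not_crossing_self: "\<not> crossing e e"
  unfolding crossing_def by (auto simp: doubleton_eq_iff)

lemma enc_noncrossing: "e \<in> enc p t \<Longrightarrow> f \<in> enc p t \<Longrightarrow> \<not> crossing e f"
proof (induction t arbitrary: p)
  case (Nd l r)
  let ?I = "{p + 1..<p + 1 + 2 * size l}"
  let ?O = "{p + 2 * size l + 2..<p + 2 * size l + 2 + 2 * size r}"
  \<comment> \<open>Any two chords then coincide, lie in the same subtree, or are separated by
    \<open>?I\<close> or \<open>?O\<close>.\<close>
  have cases: "g = {p, p + 2 * size l + 1} \<and> g \<inter> ?I = {} \<and> g \<inter> ?O = {}
      \<or> g \<in> enc (p + 1) l \<and> g \<subseteq> ?I \<and> g \<inter> ?O = {}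
      \<or> g \<in> enc (p + 2 * size l + 2) r \<and> g \<subseteq> ?O \<and> g \<inter> ?I = {}"
    if "g \<in> enc p (Nd l r)" for g
  proof -
    have "?I \<inter> ?O = {}" by auto
    moreover have "{p, p + 2 * size l + 1} \<inter> ?I = {}" "{p, p + 2 * size l + 1} \<inter> ?O = {}" by auto
    ultimately show ?thesis
      using that enc_range[of g "p + 1" l] enc_range[of g "p + 2 * size l + 2" r]
      unfolding enc.simps by blast
  qed
  show ?case
    using cases[OF Nd.prems(1)] cases[OF Nd.prems(2)] Nd.IH(1)[of "p + 1"]
      Nd.IH(2)[of "p + 2 * size l + 2"] not_crossing_self not_crossing_separated
    by metis
qed simp

lemma enc_covers: "x \<in> {p..<p + 2 * size t} \<Longrightarrow> \<exists>!e. e \<in> enc p t \<and> x \<in> e"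
proof (induction t arbitrary: p)
  case (Nd l r)
  have I: "p + 1 \<le> x \<and> x < p + 1 + 2 * size l" if "e \<in> enc (p + 1) l" "x \<in> e" for e
    using enc_range[OF that(1)] that(2) by auto
  have O: "p + 2 * size l + 2 \<le> x" if "e \<in> enc (p + 2 * size l + 2) r" "x \<in> e" for e
    using enc_range[OF that(1)] that(2) by auto
  consider "x = p \<or> x = p + 2 * size l + 1" | "p + 1 \<le> x" "x < p + 1 + 2 * size l"
    | "p + 2 * size l + 2 \<le> x" using Nd.prems unfolding atLeastLessThan_iff by linarith
  then show ?case
  proof cases
    case 1
    then have "e \<in> enc p (Nd l r) \<and> x \<in> e \<longleftrightarrow> e = {p, p + 2 * size l + 1}" for e
      using I[of e] O[of e] by auto
    then show ?thesis by simp
  next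
    case 2
    then have "e \<in> enc p (Nd l r) \<and> x \<in> e \<longleftrightarrow> e \<in> enc (p + 1) l \<and> x \<in> e" for e
      using O[of e] by auto
    moreover have "\<exists>!e. e \<in> enc (p + 1) l \<and> x \<in> e" by (rule Nd.IH(1)) (use 2 in simp)
    ultimately show ?thesis by simp
  next
    case 3
    then have "e \<in> enc p (Nd l r) \<and> x \<in> e \<longleftrightarrow> e \<in> enc (p + 2 * size l + 2) r \<and> x \<in> e" for e
      using I[of e] by auto
    moreover have "\<exists>!e. e \<in> enc (p + 2 * size l + 2) r \<and> x \<in> e"
      by (rule Nd.IH(2)) (use 3 Nd.prems in simp)
    ultimately show ?thesis by simp
  qed
qed simp

lemma is_matching_enc: "is_matching (size t) (enc 0 t)"
proof -
  have "is_edge (size t) e" if "e \<in> enc 0 t" for e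
    using enc_is_pair[OF that] unfolding is_edge_def by auto
  moreover have "\<exists>!e. e \<in> enc 0 t \<and> x \<in> e" if "x < 2 * size t" for x
    by (rule enc_covers) (use that in simp)
  ultimately show ?thesis
    unfolding is_matching_def using enc_noncrossing by blast
qed

section \<open>Rotations and blocks\<close>

text \<open>The relabelling of \<open>remove_block\<close> with an arbitrary offset, so that a
  matching can be rotated without deleting anything.\<close>

definition shift :: "nat \<Rightarrow> nat \<Rightarrow> nat set set \<Rightarrow> nat set set" where
  "shift n c M = (\<lambda>e. (\<lambda>x. (x + 2 * n - c) mod (2 * n)) ` e) ` M"

lemma shift_Suc:
  assumes "Suc c \<le> 2 * n"
  shows "shift n (Suc c) M = shift n 1 (shift n c M)"
proof -
  have "((x + 2 * n - c) mod (2 * n) + 2 * n - 1) mod (2 * n) = (x + 2 * n - Suc c) mod (2 * n)" for x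
  proof -
    have "((x + 2 * n - c) mod (2 * n) + 2 * n - 1) mod (2 * n)
        = ((x + 2 * n - c) mod (2 * n) + (2 * n - 1)) mod (2 * n)"
      using assms by simp
    also have "\<dots> = (x + 2 * n - c + (2 * n - 1)) mod (2 * n)" by (rule mod_add_left_eq)
    also have "x + 2 * n - c + (2 * n - 1) = (x + 2 * n - Suc c) + 2 * n" using assms by linarith
    finally show ?thesis by simp
  qed
  then show ?thesis unfolding shift_def by (simp add: image_image)
qed

lemma shift_point_inverse:
  fixes x n c :: nat
  assumes "c \<le> 2 * n" "x < 2 * n"
  shows "((x + 2 * n - c) mod (2 * n) + c) mod (2 * n) = x"
proof -
  have "((x + 2 * n - c) mod (2 * n) + c) mod (2 * n) = (x + 2 * n - c + c) mod (2 * n)"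
    by (rule mod_add_left_eq)
  then show ?thesis using assms by simp
qed

lemma shift_inverse:
  assumes "M \<subseteq> Pow {..<2 * n}" "c \<le> 2 * n"
  shows "shift n (2 * n - c) (shift n c M) = M"
proof -
  have *: "((x + 2 * n - c) mod (2 * n) + 2 * n - (2 * n - c)) mod (2 * n) = x" if "x < 2 * n" for x
    using shift_point_inverse[OF assms(2) that] assms(2) by simp
  have "(\<lambda>x. ((x + 2 * n - c) mod (2 * n) + 2 * n - (2 * n - c)) mod (2 * n)) ` e = e"
    if "e \<in> M" for e
  proof -
    have "\<forall>x\<in>e. x < 2 * n" using that assms by auto
    then show ?thesis using * by (simp cong: image_cong)
  qed
  then show ?thesis unfolding shift_def by (simp add: image_image cong: image_cong)
qed

lemma inj_on_shift:
  fixes M :: "nat set set"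
  assumes "M \<subseteq> Pow {..<2 * n}" "c \<le> 2 * n"
  shows "inj_on (\<lambda>e. (\<lambda>x. (x + 2 * n - c) mod (2 * n)) ` e) M"
proof -
  have "inj_on (\<lambda>x. (x + 2 * n - c) mod (2 * n)) {..<2 * n}"
    by (rule inj_on_inverseI[where g = "\<lambda>y. (y + c) mod (2 * n)"])
      (use shift_point_inverse[OF assms(2)] in simp)
  then show ?thesis using inj_on_image_Pow inj_on_subset assms(1) by blast
qed

text \<open>Point 0 becomes the last point: the first chord now closes the interval, coming after
  \<open>l\<close> and enclosing \<open>r\<close>.\<close>

lemma shift_1_enc:
  assumes "n = size (Nd l r)"
  shows "shift n 1 (enc 0 (Nd l r)) = enc 0 (app l (Nd r Lf))"
proof -
  let ?f = "\<lambda>x. (x + 2 * n - 1) mod (2 * n)"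
  have f: "?f (Suc x) = x" if "x < 2 * n" for x
    using that by simp
  have 1: "(\<lambda>e. ?f ` e) ` enc 1 l = enc 0 l"
    by (rule image_enc) (use f assms in simp)
  have 2: "(\<lambda>e. ?f ` e) ` enc (2 * size l + 2) r = enc (2 * size l + 1) r"
  proof (rule image_enc)
    fix x assume "x < 2 * size r"
    then show "?f (2 * size l + 2 + x) = 2 * size l + 1 + x"
      using f[of "2 * size l + 1 + x"] assms by simp
  qed
  have 3: "?f 0 = 2 * size l + 2 * size r + 1" using assms by simp
  have 4: "?f (2 * size l + 1) = 2 * size l" using assms f[of "2 * size l"] by simp
  show ?thesis unfolding shift_def using 1 2 3 4
    by (simp add: image_Un enc_app insert_commute del: image_cong_simp)
qed

lemma shift_enc:
  assumes "odd (size t)" "c \<le> 2 * size t"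
  shows "\<exists>t'. size t' = size t \<and> good t' = good t \<and> shift (size t) c (enc 0 t) = enc 0 t'"
  using assms(2)
proof (induction c)
  case 0
  have "shift (size t) 0 (enc 0 t) = enc 0 t"
    unfolding shift_def by (rule image_enc) simp
  then show ?case by blast
next
  case (Suc c)
  then obtain s where s: "size s = size t" "good s = good t" "shift (size t) c (enc 0 t) = enc 0 s"
    by auto
  then obtain l r where lr: "s = Nd l r" using assms(1) by (cases s) auto
  have "odd (Suc (size l + size r))" using assms(1) s(1) lr by simp
  \<comment> \<open>Odd size enters here: with equal parities the excluded combination cannot occur
    at either root, so goodness means \<open>good l\<close> and \<open>good r\<close> both before
    and after the rotation.\<close>
  then have "even (size l) = even (size r)" by simp
  then have "good (app l (Nd r Lf)) = good s" using lr by (auto simp: good_app)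
  moreover have "shift (size t) (Suc c) (enc 0 t) = enc 0 (app l (Nd r Lf))"
    using shift_Suc[OF Suc.prems] s shift_1_enc[of "size t" l r] lr by simp
  moreover have "size (app l (Nd r Lf)) = size t" using s lr by simp
  ultimately show ?case using s(2) by metis
qed

text \<open>The offset \<open>i + 4\<close> is the point just after the block, so the block lands on
  the last four points.\<close>

lemma shift_block:
  assumes "2 \<le> n"
  shows "shift n ((i + 4) mod (2 * n)) (block n i)
    = {{2 * n - 4, 2 * n - 1}, {2 * n - 3, 2 * n - 2}}"
proof -
  have *: "((i + j) mod (2 * n) + 2 * n - (i + 4) mod (2 * n)) mod (2 * n) = 2 * n - 4 + j"
    if "j < 4" for j
  proof -
    have le: "(i + 4) mod (2 * n) \<le> (i + j) mod (2 * n) + 2 * n"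
      by (intro trans_le_add2 less_imp_le mod_less_divisor) (use assms in simp)
    \<comment> \<open>Passing to the integers allows the inner reductions to be dropped from the
      difference.\<close>
    have "int (((i + j) mod (2 * n) + 2 * n - (i + 4) mod (2 * n)) mod (2 * n))
       = ((int i + int j) mod (2 * int n) + 2 * int n - (int i + 4) mod (2 * int n)) mod (2 * int n)"
      using le by (simp add: zmod_int of_nat_diff)
    also have "\<dots> = ((int i + int j) + 2 * int n - (int i + 4)) mod (2 * int n)"
      by (metis mod_add_left_eq mod_diff_eq mod_mod_trivial)
    also have "(int i + int j) + 2 * int n - (int i + 4) = 2 * int n + (int j - 4)" by simp
    also have "\<dots> mod (2 * int n) = 2 * int n + (int j - 4)" using that assms by (intro mod_pos_pos_trivial) auto
    also have "\<dots> = int (2 * n - 4 + j)" using assms by simp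
    finally show ?thesis by linarith
  qed
  have "2 * n - 4 + 1 = 2 * n - 3" "2 * n - 4 + 2 = 2 * n - 2" "2 * n - 4 + 3 = 2 * n - 1"
    using assms by auto
  then have "((i + 1) mod (2 * n) + 2 * n - (i + 4) mod (2 * n)) mod (2 * n) = 2 * n - 3"
    "((i + 2) mod (2 * n) + 2 * n - (i + 4) mod (2 * n)) mod (2 * n) = 2 * n - 2"
    "((i + 3) mod (2 * n) + 2 * n - (i + 4) mod (2 * n)) mod (2 * n) = 2 * n - 1"
    "(i mod (2 * n) + 2 * n - (i + 4) mod (2 * n)) mod (2 * n) = 2 * n - 4"
    using *[of 1] *[of 2] *[of 3] *[of 0] by (simp_all only:) simp_all
  then show ?thesis unfolding shift_def block_def by (simp only: image_insert image_empty)
qed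

section \<open>Trees ending in a block, and I-matchings as good trees\<close>

abbreviation BB :: bt where "BB \<equiv> Nd (Nd Lf Lf) Lf"

text \<open>\<open>BB\<close> is the tree of a single block. It is good and of even size, so
  appending it changes neither goodness nor parity.\<close>

lemma enc_app_BB:
  assumes "n = size t + 2"
  shows "enc 0 (app t BB) = enc 0 t \<union> {{2 * n - 4, 2 * n - 1}, {2 * n - 3, 2 * n - 2}}"
  using assms by (simp add: enc_app)

text \<open>Descent along the right spine. If nothing follows the first chord, that chord is the
  outer one of the block; if a single chord follows, it joins the last two points, which is a
  contradiction.\<close>

lemma ends_in_BB:
  assumes "{p + 2 * n - 4, p + 2 * n - 1} \<in> enc p t" 
    "{p + 2 * n - 3, p + 2 * n - 2} \<in> enc p t" "n = size t" "2 \<le> n"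
  shows "\<exists>s. t = app s BB"
  using assms
proof (induction t arbitrary: p n)
  case (Nd l r)
  consider "size r = 0" | "size r = 1" | "2 \<le> size r" by linarith
  then show ?case
  proof cases
    case 1
    then have r: "r = Lf" by (cases r) auto
    then have "{p + 2 * n - 4, p + 2 * n - 1} \<notin> enc (p + 1) l"
      using Nd.prems enc_range[of "{p + 2 * n - 4, p + 2 * n - 1}" "p + 1" l] by auto
    then have "{p + 2 * n - 4, p + 2 * n - 1} = {p, p + 2 * size l + 1}"
      using Nd.prems(1) r by simp
    then have "n = 2" using Nd.prems r by (auto simp: doubleton_eq_iff)
    then have "size l = 1" using Nd.prems r by simp
    then have "l = Nd Lf Lf" by (rule size_eq_1)
    then show ?thesis using r by (intro exI[of _ Lf]) simp
  next
    case 2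
    let ?e = "{p + 2 * n - 4, p + 2 * n - 1}"
    have "?e \<noteq> {p, p + 2 * size l + 1}" using Nd.prems(3) 2 by (auto simp: doubleton_eq_iff)
    moreover have "?e \<notin> enc (p + 1) l"
      using Nd.prems 2 enc_range[of ?e "p + 1" l] by auto
    moreover have "?e \<notin> enc (p + 2 * size l + 2) r"
      using Nd.prems 2 enc_range[of ?e "p + 2 * size l + 2" r] by auto
    ultimately show ?thesis using Nd.prems(1) by simp
  next
    case 3
    let ?q = "p + 2 * size l + 2"
    have mem: "e \<in> enc ?q r" if "e \<in> enc p (Nd l r)" "x \<in> e" "p + 2 * size l + 2 \<le> x" for e x
      using that enc_range[of e "p + 1" l] by fastforce
    have "{p + 2 * n - 4, p + 2 * n - 1} \<in> enc ?q r"
      by (rule mem[OF Nd.prems(1), of "p + 2 * n - 1"]) (use Nd.prems 3 in auto)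
    moreover have "{p + 2 * n - 3, p + 2 * n - 2} \<in> enc ?q r"
      by (rule mem[OF Nd.prems(2), of "p + 2 * n - 2"]) (use Nd.prems 3 in auto)
    moreover have "p + 2 * n = ?q + 2 * size r" using Nd.prems(3) by simp
    ultimately obtain s where "r = app s BB"
      using Nd.IH(2)[of ?q "size r"] 3 by auto
    then show ?thesis by (intro exI[of _ "Nd l s"]) simp
  qed
qed simp

text \<open>Descend into a subtree with at least two chords. If there is none, an empty
  \<open>l\<close> beside a one-chord \<open>r\<close> is the excluded parity, so \<open>l\<close>
  is one chord and the root carries a block.\<close>

lemma good_has_block:
  assumes "good t" "2 \<le> size t"
  shows "\<exists>i. {i, i + 3} \<in> enc p t \<and> {i + 1, i + 2} \<in> enc p t"
  using assms
proof (induction t arbitrary: p)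
  case (Nd l r)
  consider "2 \<le> size l" | "2 \<le> size r" | "size l \<le> 1" "size r \<le> 1" by linarith
  then show ?case
  proof cases
    case 1
    then show ?thesis using Nd.IH(1)[of "p + 1"] Nd.prems by auto
  next
    case 2
    then show ?thesis using Nd.IH(2)[of "p + 2 * size l + 2"] Nd.prems by auto
  next
    case 3
    have "size l \<noteq> 0"
    proof
      assume "size l = 0"
      moreover from this have "size r = 1" using Nd.prems(2) 3 by simp
      ultimately show False using Nd.prems(1) by simp
    qed
    then have "size l = 1" using 3 by simp
    then have "l = Nd Lf Lf" by (rule size_eq_1)
    then show ?thesis by (intro exI[of _ p]) (simp add: numeral_eq_Suc)
  qed
qed simp

text \<open>With the block rotated to the last four points, restoring it appends \<open>BB\<close>
  to the tree of the smaller matching; completing the full turn recovers \<open>M\<close>.\<close>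

lemma I_matching_imp_good:
  "I_matching n M \<Longrightarrow> odd n \<and> (\<exists>t. size t = n \<and> good t \<and> M = enc 0 t)"
proof (induction rule: I_matching.induct)
  case base
  show ?case by (intro conjI exI[of _ "Nd Lf Lf"]) auto
next
  case (step n M i)
  then obtain s where s: "size s = n - 2" "good s" "remove_block n i M = enc 0 s" by auto
  define c where "c = (i + 4) mod (2 * n)"
  have c: "c \<le> 2 * n" using step.hyps(2) unfolding c_def by (intro less_imp_le mod_less_divisor) simp
  have M: "M \<subseteq> Pow {..<2 * n}"
    using step.hyps(3) unfolding is_matching_def is_edge_def by fastforce
  have "M = (M - block n i) \<union> block n i" using step.hyps(5) by blast
  then have "shift n c M = shift n c (M - block n i) \<union> shift n c (block n i)"
    unfolding shift_def by (metis image_Un)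
  also have "shift n c (M - block n i) = enc 0 s"
    using s(3) unfolding remove_block_def shift_def c_def .
  also have "shift n c (block n i) = {{2 * n - 4, 2 * n - 1}, {2 * n - 3, 2 * n - 2}}"
    unfolding c_def by (rule shift_block) (use step.hyps in simp)
  also have "enc 0 s \<union> \<dots> = enc 0 (app s BB)"
    by (rule enc_app_BB[symmetric]) (use s step.hyps in simp)
  finally have sh: "shift n c M = enc 0 (app s BB)" .
  have sz: "size (app s BB) = n" using s step.hyps by simp
  have good: "good (app s BB)" using s by (simp add: good_app)
  obtain t where "size t = n" "good t" "shift n (2 * n - c) (enc 0 (app s BB)) = enc 0 t"
    using shift_enc[of "app s BB" "2 * n - c"] sz good step.hyps(1) by auto
  then show ?case using shift_inverse[OF M c] sh step.hyps(1) by auto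
qed

text \<open>Goodness survives rotating a chosen block to the end, where deleting it leaves a good
  prefix \<open>s\<close> to which the induction applies.\<close>

lemma good_imp_I_matching: "odd n \<Longrightarrow> size t = n \<Longrightarrow> good t \<Longrightarrow> I_matching n (enc 0 t)"
proof (induction n arbitrary: t rule: less_induct)
  case (less n)
  show ?case
  proof (cases "n = 1")
    case True
    then have "t = Nd Lf Lf" using less.prems by (intro size_eq_1) simp
    then show ?thesis using True I_matching.base by simp
  next
    case False
    then have n: "3 \<le> n" using less.prems(1) by (auto elim: oddE)
    obtain i where i: "{i, i + 3} \<in> enc 0 t" "{i + 1, i + 2} \<in> enc 0 t"
      using good_has_block[of t 0] less.prems n by auto
    have i3: "i + 3 < 2 * n" using enc_range[OF i(1)] less.prems by auto
    \<comment> \<open>The block found does not wrap around, so the residues in \<open>block\<close>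
      are the points themselves.\<close>
    then have bl: "block n i \<subseteq> enc 0 t" using i unfolding block_def by simp
    define c where "c = (i + 4) mod (2 * n)"
    have c: "c \<le> 2 * n" using n unfolding c_def by (intro less_imp_le mod_less_divisor) simp
    obtain t' where t': "size t' = n" "good t'" "shift n c (enc 0 t) = enc 0 t'"
      using shift_enc[of t c] c less.prems by auto
    let ?B = "{{2 * n - 4, 2 * n - 1}, {2 * n - 3, 2 * n - 2}}"
    have shB: "shift n c (block n i) = ?B" unfolding c_def by (rule shift_block) (use n in simp)
    have "?B \<subseteq> enc 0 t'"
      unfolding shB[symmetric] t'(3)[symmetric] using bl unfolding shift_def by (rule image_mono)
    then have "{2 * n - 4, 2 * n - 1} \<in> enc 0 t'" "{2 * n - 3, 2 * n - 2} \<in> enc 0 t'"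
      by blast+
    moreover have "2 \<le> n" using n by simp
    ultimately obtain s where s: "t' = app s BB"
      using ends_in_BB[of 0 n t', unfolded add_0] t'(1) by blast
    then have szs: "n = size s + 2" using t'(1) by simp
    have "{2 * n - 4, 2 * n - 1} \<notin> enc 0 s" "{2 * n - 3, 2 * n - 2} \<notin> enc 0 s"
      using enc_range[of "{2 * n - 4, 2 * n - 1}" 0 s]
        enc_range[of "{2 * n - 3, 2 * n - 2}" 0 s] szs by auto
    then have "enc 0 s \<inter> ?B = {}" by blast
    then have *: "enc 0 t' - ?B = enc 0 s" unfolding s enc_app_BB[OF szs] by blast
    \<comment> \<open>\<open>remove_block\<close> deletes before relabelling, whereas
      \<open>*\<close> deletes afterwards; injectivity reconciles the two.\<close>
    have inj: "inj_on (\<lambda>e. (\<lambda>x. (x + 2 * n - c) mod (2 * n)) ` e) (enc 0 t)"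
    proof (rule inj_on_shift[OF _ c])
      show "enc 0 t \<subseteq> Pow {..<2 * n}"
        using enc_range[of _ 0 t] less.prems(2) by fastforce
    qed
    have "remove_block n i (enc 0 t) = shift n c (enc 0 t) - shift n c (block n i)"
      unfolding remove_block_def shift_def c_def[symmetric]
      using inj bl by (intro inj_on_image_set_diff) auto
    then have rem: "remove_block n i (enc 0 t) = enc 0 s" using t'(3) shB * by simp
    have good: "good s" using t'(2) unfolding s good_app by blast
    have "odd (n - 2)" using less.prems(1) n by simp
    moreover have "size s = n - 2" "n - 2 < n" using szs by simp_all
    ultimately have "I_matching (n - 2) (remove_block n i (enc 0 t))"
      unfolding rem using less.IH good by blast
    moreover have "is_matching n (enc 0 t)" using is_matching_enc[of t] unfolding less.prems(2) .
    moreover have "i < 2 * n" using i3 by simp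
    ultimately show ?thesis
      using I_matching.step[OF less.prems(1) n] bl by blast
  qed
qed

section \<open>Counting\<close>

definition goods :: "nat \<Rightarrow> bt set" where
  "goods n = {t. size t = n \<and> good t}"

text \<open>For even \<open>n\<close> every size of the left subtree is admissible, for odd
  \<open>n\<close> exactly the odd sizes; hence two different functional equations.\<close>

definition joinable :: "nat \<Rightarrow> nat set" where
  "joinable n = {i. i \<le> n \<and> \<not> (even i \<and> odd (n - i))}"

lemma goods_0: "goods 0 = {Lf}"
proof (intro equalityI subsetI)
  fix t assume "t \<in> goods 0"
  then show "t \<in> {Lf}" unfolding goods_def by (cases t) simp_all
qed (simp add: goods_def)

lemma goods_Suc:
  "goods (Suc n) = (\<Union>i\<in>joinable n. (\<lambda>(l, r). Nd l r) ` (goods i \<times> goods (n - i)))"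
proof (intro equalityI subsetI)
  fix t assume t: "t \<in> goods (Suc n)"
  then obtain l r where lr: "t = Nd l r" unfolding goods_def by (cases t) auto
  then have "size l + size r = n" using t unfolding goods_def by simp
  then have "size l \<in> joinable n" "l \<in> goods (size l)" "r \<in> goods (n - size l)"
    using t lr unfolding goods_def joinable_def by auto
  then show "t \<in> (\<Union>i\<in>joinable n. (\<lambda>(l, r). Nd l r) ` (goods i \<times> goods (n - i)))"
    using lr by blast
next
  fix t assume "t \<in> (\<Union>i\<in>joinable n. (\<lambda>(l, r). Nd l r) ` (goods i \<times> goods (n - i)))"
  then show "t \<in> goods (Suc n)" unfolding goods_def joinable_def by auto
qed

lemma finite_goods: "finite (goods n)"
proof (induction n rule: less_induct)
  case (less n)
  show ?case
  proof (cases n)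
    case 0
    then show ?thesis by (simp add: goods_0)
  next
    case (Suc m)
    have "finite (goods i \<times> goods (m - i))" if "i \<in> joinable m" for i
      using less.IH[of i] less.IH[of "m - i"] that Suc unfolding joinable_def by simp
    then show ?thesis unfolding Suc goods_Suc by (auto simp: joinable_def)
  qed
qed

lemma card_goods_Suc:
  "card (goods (Suc n)) = (\<Sum>i\<in>joinable n. card (goods i) * card (goods (n - i)))"
proof -
  have "card (goods (Suc n))
      = (\<Sum>i\<in>joinable n. card ((\<lambda>(l, r). Nd l r) ` (goods i \<times> goods (n - i))))"
    unfolding goods_Suc
  proof (rule card_UN_disjoint)
    show "finite (joinable n)" unfolding joinable_def by simp
    show "\<forall>i\<in>joinable n. finite ((\<lambda>(l, r). Nd l r) ` (goods i \<times> goods (n - i)))"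
      using finite_goods by simp
    show "\<forall>i\<in>joinable n. \<forall>j\<in>joinable n. i \<noteq> j \<longrightarrow>
        (\<lambda>(l, r). Nd l r) ` (goods i \<times> goods (n - i)) \<inter>
        (\<lambda>(l, r). Nd l r) ` (goods j \<times> goods (n - j)) = {}"
      unfolding goods_def by auto
  qed
  also have "\<dots> = (\<Sum>i\<in>joinable n. card (goods i) * card (goods (n - i)))"
    by (intro sum.cong refl) (simp add: card_image inj_on_def card_cartesian_product)
  finally show ?thesis .
qed

section \<open>Generating functions by parity and their functional equations\<close>

definition fps_odd :: "real fps" where
  "fps_odd = Abs_fps (\<lambda>n. if odd n then real (card (goods n)) else 0)"

definition fps_even :: "real fps" where
  "fps_even = Abs_fps (\<lambda>n. if even n then real (card (goods n)) else 0)"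

text \<open>Extending the sum by zeros to \<open>0..n\<close> gives it the shape of a Cauchy
  product.\<close>

lemma real_card_goods_Suc:
  "real (card (goods (Suc n))) = (\<Sum>i=0..n. if even i \<and> odd (n - i) then 0
     else real (card (goods i)) * real (card (goods (n - i))))"
proof -
  have "real (card (goods (Suc n))) = (\<Sum>i\<in>joinable n. real (card (goods i)) * real (card (goods (n - i))))"
    by (simp add: card_goods_Suc)
  also have "\<dots> = (\<Sum>i=0..n. if even i \<and> odd (n - i) then 0
     else real (card (goods i)) * real (card (goods (n - i))))"
    by (rule sum.mono_neutral_cong_left) (auto simp: joinable_def)
  finally show ?thesis .
qed

lemma fps_even_eq: "fps_even = 1 + fps_X * (fps_odd * fps_even)"
proof (rule fps_ext)
  fix n
  show "fps_nth fps_even n = fps_nth (1 + fps_X * (fps_odd * fps_even)) n"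
  proof (cases n)
    case 0
    then show ?thesis by (simp add: fps_even_def goods_0)
  next
    case (Suc m)
    have "fps_nth fps_even (Suc m) = (\<Sum>i=0..m. fps_nth fps_odd i * fps_nth fps_even (m - i))"
    \<comment> \<open>For odd \<open>m\<close> only odd \<open>i\<close> with even
      \<open>m - i\<close> survive; for even \<open>m\<close> every product has a zero
      factor.\<close>
    proof (cases "odd m")
      case True
      then show ?thesis
        unfolding fps_even_def fps_odd_def fps_nth_Abs_fps real_card_goods_Suc
        by (auto intro!: sum.cong)
    next
      case False
      then show ?thesis
        unfolding fps_even_def fps_odd_def fps_nth_Abs_fps
        by (auto intro!: sum.neutral)
    qed
    also have "\<dots> = fps_nth (1 + fps_X * (fps_odd * fps_even)) (Suc m)"
      by (simp flip: fps_mult_nth)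
    finally show ?thesis using Suc by simp
  qed
qed

lemma fps_odd_eq: "fps_odd = fps_X * (fps_odd * fps_odd + fps_even * fps_even)"
proof (rule fps_ext)
  fix n
  show "fps_nth fps_odd n = fps_nth (fps_X * (fps_odd * fps_odd + fps_even * fps_even)) n"
  proof (cases n)
    case 0
    then show ?thesis by (simp add: fps_odd_def)
  next
    case (Suc m)
    have "fps_nth fps_odd (Suc m) = (\<Sum>i=0..m. fps_nth fps_odd i * fps_nth fps_odd (m - i)
        + fps_nth fps_even i * fps_nth fps_even (m - i))"
    \<comment> \<open>For even \<open>m\<close> the two parities agree, so nothing is excluded; for
      odd \<open>m\<close> every product vanishes.\<close>
    proof (cases "odd m")
      case True
      then show ?thesis
        unfolding fps_even_def fps_odd_def fps_nth_Abs_fps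
        by (auto intro!: sum.neutral)
    next
      case False
      then show ?thesis
        unfolding fps_even_def fps_odd_def fps_nth_Abs_fps real_card_goods_Suc
        by (auto intro!: sum.cong)
    qed
    also have "\<dots> = fps_nth (fps_X * (fps_odd * fps_odd + fps_even * fps_even)) (Suc m)"
      by (simp add: sum.distrib flip: fps_mult_nth)
    finally show ?thesis using Suc by simp
  qed
qed

text \<open>\<open>1 - fps_X * fps_odd\<close> is the inverse of \<open>fps_even\<close>, and its
  product with \<open>fps_odd\<close> is \<open>fps_X * fps_even ^ 2\<close>.\<close>

lemma fps_odd_eq_even_cubed: "fps_odd = fps_X * fps_even ^ 3"
proof -
  let ?A = fps_odd and ?B = fps_even
  have 1: "?B * (1 - fps_X * ?A) = 1" using fps_even_eq by (simp add: algebra_simps)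
  have 2: "?A * (1 - fps_X * ?A) = fps_X * ?B * ?B" using fps_odd_eq by (simp add: algebra_simps)
  have "?A = ?A * (?B * (1 - fps_X * ?A))" by (simp add: 1)
  also have "\<dots> = ?B * (?A * (1 - fps_X * ?A))" by (simp only: mult_ac)
  also have "\<dots> = ?B * (fps_X * ?B * ?B)" by (simp only: 2)
  finally show ?thesis by (simp add: power3_eq_cube mult_ac)
qed

section \<open>Coefficients of the powers of \<open>fps_even\<close>\<close>

lemma fps_even_power_Suc:
  "fps_even ^ Suc r = fps_even ^ r + fps_X ^ 2 * fps_even ^ (r + 4)"
proof -
  have "fps_even = 1 + fps_X ^ 2 * fps_even ^ 4"
    using fps_even_eq unfolding fps_odd_eq_even_cubed
    by (simp add: power2_eq_square power3_eq_cube power4_eq_xxxx mult_ac)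
  then have "fps_even ^ Suc r = fps_even ^ r * (1 + fps_X ^ 2 * fps_even ^ 4)"
    by (metis power_Suc2)
  then show ?thesis by (simp add: algebra_simps power_add)
qed

text \<open>Pascal's rule guarded at \<open>n = 0\<close>, where the truncated \<open>n - 1\<close>
  would give 1 instead of 0.\<close>

lemma Suc_choose: "(Suc N choose n) = (N choose n) + (if n = 0 then 0 else (N choose (n - 1)))"
  by (cases n) simp_all

text \<open>These are the Raney numbers (r+1)/(4n+r+1) * binom(4n+r+1, n), written without division
  so that the recurrence becomes Pascal's rule in each term.\<close>

lemma fps_even_power_nth:
  "fps_nth (fps_even ^ Suc r) (2 * n)
     = real (4 * n + r choose n) - 3 * (if n = 0 then 0 else real (4 * n + r choose (n - 1)))"
proof (induction n arbitrary: r)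
  case 0
  have "fps_nth (fps_even ^ Suc r) 0 = 1" by (simp add: fps_even_def goods_0 fps_power_zeroth)
  then show ?case by simp
next
  case (Suc n)
  note IHn = Suc.IH
  have step: "fps_nth (fps_even ^ Suc r) (2 * Suc n)
      = fps_nth (fps_even ^ r) (2 * Suc n) + fps_nth (fps_even ^ Suc (r + 3)) (2 * n)" for r
    by (subst fps_even_power_Suc) (simp add: fps_X_power_mult_nth numeral_eq_Suc del: power_Suc)
  show ?case
  proof (induction r)
    case 0
    \<comment> \<open>Boundary case: \<open>fps_even ^ 0\<close> contributes nothing, so the
      binomials left over from Pascal's rule must cancel. They do, since (4n+3) - n =
      3(n+1).\<close>
    have "Suc n * (4 * n + 3 choose Suc n) = Suc n * (3 * (4 * n + 3 choose n))"
      using Suc_times_binomial_add[of n "3 * n + 2"] by (simp add: algebra_simps eval_nat_numeral)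
    then have eq: "(4 * n + 3 choose Suc n) = 3 * (4 * n + 3 choose n)"
      using mult_left_cancel[of "Suc n"] by blast
    have "4 * Suc n + 0 = Suc (4 * n + 3)" by simp
    moreover have "(Suc (4 * n + 3) choose n)
        = (4 * n + 3 choose n) + (if n = 0 then 0 else (4 * n + 3 choose (n - 1)))"
      by (rule Suc_choose)
    moreover have "fps_nth (fps_even ^ 0) (2 * Suc n) = 0" by simp
    ultimately show ?case
      using step[of 0] Suc.IH[of 3] eq by (simp only: binomial_Suc_Suc of_nat_add) simp
  next
    case (Suc r)
    have "4 * Suc n + Suc r = Suc (4 * n + (r + 4))" "Suc r + 3 = r + 4" "4 * Suc n + r = 4 * n + (r + 4)"
      by simp_all
    moreover have "(Suc (4 * n + (r + 4)) choose n)
        = (4 * n + (r + 4) choose n) + (if n = 0 then 0 else (4 * n + (r + 4) choose (n - 1)))"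
      by (rule Suc_choose)
    ultimately show ?case
      using step[of "Suc r"] Suc.IH IHn[of "r + 4"]
      by (simp only: binomial_Suc_Suc of_nat_add) simp
  qed
qed

text \<open>The case \<open>r = 2\<close> of the coefficient formula, as \<open>fps_odd\<close> is
  \<open>fps_X\<close> times a cube.\<close>

lemma card_goods_odd:
  "real (card (goods (2 * m + 1))) = real (4 * m + 2 choose m) / real (m + 1)"
proof -
  have "real (card (goods (2 * m + 1))) = fps_nth fps_odd (Suc (2 * m))"
    by (simp add: fps_odd_def)
  also have "\<dots> = fps_nth (fps_even ^ Suc 2) (2 * m)"
    unfolding fps_odd_eq_even_cubed by (simp add: numeral_eq_Suc del: power_Suc)
  also have "\<dots> = real (4 * m + 2 choose m) - 3 * (if m = 0 then 0 else real (4 * m + 2 choose (m - 1)))"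
    by (rule fps_even_power_nth)
  also have "\<dots> = real (4 * m + 2 choose m) / real (m + 1)"
  proof (cases m)
    case (Suc a)
    \<comment> \<open>Makes the subtracted term m/(m+1) times the leading binomial.\<close>
    have eq: "m * (4 * m + 2 choose m) = 3 * (m + 1) * (4 * m + 2 choose a)"
      using Suc_times_binomial_add[of a "3 * a + 5"] Suc by (simp add: algebra_simps eval_nat_numeral)
    have "real m * real (4 * m + 2 choose m) = 3 * (real m + 1) * real (4 * m + 2 choose a)"
      using arg_cong[OF eq, of real] by (simp only: of_nat_mult of_nat_add of_nat_1 of_nat_numeral)
    moreover have "(if m = 0 then 0 else real (4 * m + 2 choose (m - 1))) = real (4 * m + 2 choose a)"
      using Suc by simp
    ultimately show ?thesis by (simp only:) (simp add: field_simps)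
  qed simp
  finally show ?thesis .
qed

theorem mainTheorem12:
  fixes k :: nat
  assumes "odd k"
  shows "real (card {M. I_matching k M}) =
           real ((4 * ((k + 1) div 2) - 2) choose ((k + 1) div 2 - 1)) / real ((k + 1) div 2)"
proof -
  \<comment> \<open>The ceiling of k/2 is then \<open>m + 1\<close>.\<close>
  obtain m where m: "k = 2 * m + 1" using assms by (elim oddE)
  have "{M. I_matching k M} = enc 0 ` goods k"
    using I_matching_imp_good good_imp_I_matching assms unfolding goods_def by blast
  then have "card {M. I_matching k M} = card (goods k)"
    by (simp add: card_image inj_on_def enc_inj)
  then have "real (card {M. I_matching k M}) = real (4 * m + 2 choose m) / real (m + 1)"
    using card_goods_odd[of m] m by simp
  moreover have "(k + 1) div 2 = m + 1" "4 * (m + 1) - 2 = 4 * m + 2" "m + 1 - 1 = m"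
    using m by simp_all
  ultimately show ?thesis by (simp only:)
qed

end
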